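(* Let $(G,b,m)$, $G=(V,\vec E)$, be a finite connected weighted directed graph satisfying the standing assumptions in the context, with $n$ vertices, and let $G_1$ be a weighted directed graph obtained by adding a set of directed edges to $G$ (same vertex set $V$, same $m$, and the weights of the edges of $G$ unchanged). Then for all $k=1,\dots,n$, $$\lambda_k(S_G)\le\lambda_k(S_{G_1}).$$
   Context: Setting. $G=(V,\vec E)$ is a directed graph with $V$ a finite nonempty set and $\vec E\subset V\times V$; $b:V\times V\to[0,\infty)$ satisfies $b(x,x)=0$ for all $x$ and $b(x,y)>0$ iff $(x,y)\in\vec E$; $m:V\to(0,\infty)$. Put $V_x^+=\{y:(x,y)\in\vec E\}$, $V_x^-=\{y:(y,x)\in\vec E\}$, $V_x=V_x^+\cup V_x^-$. Standing assumptions (for $G$ and also for $G_1$): (i) connected: any two distinct vertices are joined by a directed path from one of them to the other; (ii) $V_x^+\ne\emptyset$ and $V_x^-\neq\emptyset$ for all $x$; (iii) Assumption $(\beta)$: $\sum_{y\in V_x^+}b(x,y)=\sum_{y\in V_x^-}b(y,x)$ for all $x\in V$. Functions $f:V\to\mathbb C$ carry the inner product $(f,g)_m=\sum_{x}m(x)f(x)\overline{g(x)}$. With $a(x,y)=b(x,y)+b(y,x)$, the special Laplacian is the self-adjoint operator $S_Gf(x)=\frac1{m(x)}\sum_{y\in V_x}a(x,y)(f(x)-f(y))$. Its eigenvalues are listed in nondecreasing order with multiplicity. "$G_1=(V,\vec E_1)$ is obtained by adding a set of edges to $G$" means $\vec E\subset\vec E_1$ and the weight $b_1$ of $G_1$ satisfies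 $b_1(x,y)=b(x,y)$ for $(x,y)\in\vec E$; $S_{G_1}$ is the same formula with $b_1$. *)

theory Defs
  imports "HOL-Analysis.Analysis" "HOL-Library.Multiset"
begin

text \<open>
  The finite nonempty vertex set is a finite type \<open>'v\<close>. Functions on the vertices are vectors in
  \<open>complex ^ 'v\<close>, whose complex dimension function is \<open>vec.dim\<close>.
\<close>

definition out_nbrs :: "('v \<times> 'v) set \<Rightarrow> 'v \<Rightarrow> 'v set"
  where "out_nbrs E x = {y. (x, y) \<in> E}"

definition in_nbrs :: "('v \<times> 'v) set \<Rightarrow> 'v \<Rightarrow> 'v set"
  where "in_nbrs E x = {y. (y, x) \<in> E}"

definition nbrs :: "('v \<times> 'v) set \<Rightarrow> 'v \<Rightarrow> 'v set"
  where "nbrs E x = out_nbrs E x \<union> in_nbrs E x"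

locale weighted_digraph =
  fixes E :: "('v::finite \<times> 'v) set"
    and b :: "'v \<Rightarrow> 'v \<Rightarrow> real"
    and m :: "'v \<Rightarrow> real"
  assumes weight_nonneg: "b x y \<ge> 0"
    and weight_diag: "b x x = 0"
    and weight_pos_iff: "b x y > 0 \<longleftrightarrow> (x, y) \<in> E"
    and measure_pos: "m x > 0"

text \<open>
  Connectedness asks for a directed path in at least one of the two directions; it is not strong
  connectedness.
\<close>

locale standing_digraph = weighted_digraph +
  assumes connected: "x \<noteq> y \<Longrightarrow> (x, y) \<in> E\<^sup>+ \<or> (y, x) \<in> E\<^sup>+"
    and out_nonempty: "out_nbrs E x \<noteq> {}"
    and in_nonempty: "in_nbrs E x \<noteq> {}"
    and assumption_beta: "(\<Sum>y\<in>out_nbrs E x. b x y) = (\<Sum>y\<in>in_nbrs E x. b y x)"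

definition adds_edges ::
  "('v \<times> 'v) set \<Rightarrow> ('v \<Rightarrow> 'v \<Rightarrow> real) \<Rightarrow> ('v \<times> 'v) set \<Rightarrow> ('v \<Rightarrow> 'v \<Rightarrow> real) \<Rightarrow> bool"
  where "adds_edges E b E1 b1 \<longleftrightarrow> E \<subseteq> E1 \<and> (\<forall>(x, y)\<in>E. b1 x y = b x y)"

definition sym_weight :: "('v \<Rightarrow> 'v \<Rightarrow> real) \<Rightarrow> 'v \<Rightarrow> 'v \<Rightarrow> real"
  where "sym_weight b x y = b x y + b y x"

definition special_laplacian ::
  "('v::finite \<times> 'v) set \<Rightarrow> ('v \<Rightarrow> 'v \<Rightarrow> real) \<Rightarrow> ('v \<Rightarrow> real) \<Rightarrow> complex ^ 'v \<Rightarrow> complex ^ 'v"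
  where "special_laplacian E b m f =
    (\<chi> x. 1 / of_real (m x) * (\<Sum>y\<in>nbrs E x. of_real (sym_weight b x y) * (f $ x - f $ y)))"

definition weighted_inner :: "('v::finite \<Rightarrow> real) \<Rightarrow> complex ^ 'v \<Rightarrow> complex ^ 'v \<Rightarrow> complex"
  where "weighted_inner m f g = (\<Sum>x\<in>UNIV. of_real (m x) * f $ x * cnj (g $ x))"

definition eigenspace :: "(complex ^ 'v \<Rightarrow> complex ^ 'v) \<Rightarrow> complex \<Rightarrow> (complex ^ 'v) set"
  where "eigenspace T \<mu> = {f. T f = \<mu> *s f}"

definition spectrum :: "(complex ^ 'v \<Rightarrow> complex ^ 'v) \<Rightarrow> complex set"
  where "spectrum T = {\<mu>. \<exists>f. f \<noteq> 0 \<and> f \<in> eigenspace T \<mu>}"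

text \<open>
  The eigenvalues of a self-adjoint operator in nondecreasing order, each repeated as often as the
  dimension of its eigenspace. They are real (see \<open>special_laplacian_spectrum_real\<close> below), so
  taking real parts loses nothing. The numbering starts at 1.
\<close>

definition eigenvalue_list :: "(complex ^ 'v::finite \<Rightarrow> complex ^ 'v) \<Rightarrow> real list"
  where "eigenvalue_list T = sorted_list_of_multiset
    (\<Sum>\<mu>\<in>spectrum T. replicate_mset (vec.dim (eigenspace T \<mu>)) (Re \<mu>))"

definition nth_eigenvalue :: "(complex ^ 'v::finite \<Rightarrow> complex ^ 'v) \<Rightarrow> nat \<Rightarrow> real"
  where "nth_eigenvalue T k = eigenvalue_list T ! (k - 1)"

context weighted_digraph
begin

lemma special_laplacian_self_adjoint:
  "weighted_inner m (special_laplacian E b m f) g = weighted_inner m f (special_laplacian E b m g)"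
proof -
  let ?a = "\<lambda>x y. complex_of_real (sym_weight b x y)"
  have a0: "?a x y = 0" if "y \<notin> nbrs E x" for x y
  proof -
    have "\<not> b x y > 0" "\<not> b y x > 0"
      using that by (auto simp: weight_pos_iff nbrs_def out_nbrs_def in_nbrs_def)
    then have "b x y = 0" "b y x = 0"
      using weight_nonneg[of x y] weight_nonneg[of y x] by linarith+
    then show ?thesis by (simp add: sym_weight_def)
  qed
  have sum_all: "(\<Sum>y\<in>nbrs E x. ?a x y * (h $ x - h $ y)) = (\<Sum>y\<in>UNIV. ?a x y * (h $ x - h $ y))"
    for x and h :: "complex ^ 'v"
    by (rule sum.mono_neutral_left) (auto simp: a0)
  have m_cancel: "complex_of_real (m x) * special_laplacian E b m h $ x =
      (\<Sum>y\<in>UNIV. ?a x y * (h $ x - h $ y))" for x and h :: "complex ^ 'v"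
    unfolding sum_all[symmetric] using measure_pos[of x] by (simp add: special_laplacian_def)
  have L: "weighted_inner m (special_laplacian E b m f) g =
      (\<Sum>x\<in>UNIV. \<Sum>y\<in>UNIV. ?a x y * (f $ x * cnj (g $ x))) -
      (\<Sum>x\<in>UNIV. \<Sum>y\<in>UNIV. ?a x y * (f $ y * cnj (g $ x)))"
    unfolding weighted_inner_def m_cancel
    unfolding sum_subtractf[symmetric] sum_distrib_right by (simp add: algebra_simps)
  have m_cancel': "complex_of_real (m x) * f $ x * cnj (special_laplacian E b m g $ x) =
      f $ x * (\<Sum>y\<in>UNIV. ?a x y * (cnj (g $ x) - cnj (g $ y)))" for x
    using arg_cong[OF m_cancel[of x g], of "\<lambda>z. f $ x * cnj z"] by (simp add: ac_simps)
  have R: "weighted_inner m f (special_laplacian E b m g) =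
      (\<Sum>x\<in>UNIV. \<Sum>y\<in>UNIV. ?a x y * (f $ x * cnj (g $ x))) -
      (\<Sum>x\<in>UNIV. \<Sum>y\<in>UNIV. ?a x y * (f $ x * cnj (g $ y)))"
    unfolding weighted_inner_def m_cancel'
    unfolding sum_subtractf[symmetric] sum_distrib_left by (simp add: algebra_simps)
  have "(\<Sum>x\<in>UNIV. \<Sum>y\<in>UNIV. ?a x y * (f $ y * cnj (g $ x))) =
      (\<Sum>x\<in>UNIV. \<Sum>y\<in>UNIV. ?a x y * (f $ x * cnj (g $ y)))"
    by (subst sum.swap) (simp add: sym_weight_def add.commute)
  with L R show ?thesis by simp
qed

lemma special_laplacian_spectrum_real:
  assumes "\<mu> \<in> spectrum (special_laplacian E b m)"
  shows "\<mu> \<in> \<real>"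
proof -
  obtain f where f: "f \<noteq> 0" "special_laplacian E b m f = \<mu> *s f"
    using assms by (auto simp: spectrum_def eigenspace_def)
  let ?N = "\<Sum>x\<in>UNIV. m x * (cmod (f $ x))\<^sup>2"
  have N: "weighted_inner m f f = of_real ?N"
    by (simp add: weighted_inner_def mult.assoc complex_norm_square del: of_real_power)
  obtain x where "f $ x \<noteq> 0"
    using f(1) by (auto simp: vec_eq_iff)
  then have "?N > 0"
    by (intro sum_pos2[of _ x]) (auto simp: measure_pos less_imp_le)
  then have "weighted_inner m f f \<noteq> 0"
    unfolding N of_real_eq_0_iff by simp
  moreover have "\<mu> * weighted_inner m f f = cnj \<mu> * weighted_inner m f f"
    using special_laplacian_self_adjoint[of f f] unfolding f(2)
    by (simp add: weighted_inner_def sum_distrib_left ac_simps)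
  ultimately show ?thesis
    by (simp add: Reals_cnj_iff)
qed

end

end

theory Submission
  imports Defs
begin

text \<open>
  For a self-adjoint operator the number of eigenvalues at most \<open>t\<close>, with multiplicity, is the
  dimension of the sum \<open>U\<close> of the corresponding eigenspaces, and the sum \<open>V\<close> of the remaining ones
  has the complementary dimension. If the quadratic form of \<open>T\<close> is below that of \<open>T'\<close>, then the
  space \<open>U'\<close> of \<open>T'\<close> meets the space \<open>V\<close> of \<open>T\<close> only in 0, so \<open>T'\<close> has at most as many
  eigenvalues up to \<open>t\<close> as \<open>T\<close>. The form of the special Laplacian is
  \<open>1/2 \<Sum> a(x,y) |f(x) - f(y)|\<^sup>2\<close>, and adding edges only increases \<open>a\<close>.
\<close>

section \<open>The weighted inner product\<close>

lemma weighted_inner_add_left: "weighted_inner m (f + g) h = weighted_inner m f h + weighted_inner m g h"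
  and weighted_inner_add_right: "weighted_inner m h (f + g) = weighted_inner m h f + weighted_inner m h g"
  and weighted_inner_diff_left: "weighted_inner m (f - g) h = weighted_inner m f h - weighted_inner m g h"
  and weighted_inner_scale_left: "weighted_inner m (c *s f) h = c * weighted_inner m f h"
  and weighted_inner_scale_right: "weighted_inner m h (c *s f) = cnj c * weighted_inner m h f"
  and weighted_inner_zero_left: "weighted_inner m 0 h = 0"
  and weighted_inner_zero_right: "weighted_inner m h 0 = 0"
  by (simp_all add: weighted_inner_def algebra_simps sum.distrib sum_subtractf sum_distrib_left)

lemma weighted_inner_commute: "weighted_inner m g f = cnj (weighted_inner m f g)"
  by (simp add: weighted_inner_def mult.commute mult.left_commute)

lemmas weighted_inner_simps = weighted_inner_add_left weighted_inner_add_right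
  weighted_inner_diff_left weighted_inner_scale_left weighted_inner_scale_right
  weighted_inner_zero_left weighted_inner_zero_right

lemma scaleR_eq_vector_scalar_mult: "r *\<^sub>R f = complex_of_real r *s f"
  by (simp add: vec_eq_iff scaleR_conv_of_real[where 'a = complex])

text \<open>First-order condition at a minimum: near \<open>s = 0\<close> a nonzero linear term
  outweighs the quadratic one and takes both signs. It is applied below to a perturbed minimiser of
  the Rayleigh quotient.\<close>

lemma real_linear_coeff_zero:
  fixes a c :: real
  assumes "\<And>s. 0 \<le> s * a + s\<^sup>2 * c"
  shows "a = 0"
proof (rule ccontr)
  assume "a \<noteq> 0"
  \<comment> \<open>Since \<open>c < K\<close>, the choice \<open>s = - a / K\<close> makes the
    linear term dominate; the total is \<open>(a\<^sup>2 / K) * (c / K - 1)\<close>.\<close>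
  define K where "K = \<bar>c\<bar> + 1"
  have K: "K > 0" "c < K" by (simp_all add: K_def)
  have "0 \<le> (- a / K) * a + (- a / K)\<^sup>2 * c"
    by (rule assms)
  also have "\<dots> = (a\<^sup>2 / K) * (c / K - 1)"
    using K by (simp add: field_simps power2_eq_square)
  also have "\<dots> < 0"
    using K \<open>a \<noteq> 0\<close> by (intro mult_pos_neg) (auto simp: field_simps)
  finally show False by simp
qed

section \<open>Self-adjoint operators: real eigenvalues and orthogonal eigenspaces\<close>

locale weighted_self_adjoint =
  fixes m :: "'v::finite \<Rightarrow> real" and T :: "complex ^ 'v \<Rightarrow> complex ^ 'v"
  assumes pos: "m x > 0"
    and T_add: "T (f + g) = T f + T g"
    and T_scale: "T (c *s f) = c *s T f"
    and self_adjoint: "weighted_inner m (T f) g = weighted_inner m f (T g)"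
begin

lemma T_zero: "T 0 = 0"
  using T_scale[of 0 0] by simp

lemma linear_T: "linear T"
  by (rule linearI) (simp_all add: T_add T_scale scaleR_eq_vector_scalar_mult)

definition sq_norm :: "complex ^ 'v \<Rightarrow> real"
  where "sq_norm f = Re (weighted_inner m f f)"

definition form :: "complex ^ 'v \<Rightarrow> real"
  where "form f = Re (weighted_inner m (T f) f)"

lemma weighted_inner_self: "weighted_inner m f f = of_real (\<Sum>x\<in>UNIV. m x * (cmod (f $ x))\<^sup>2)"
  by (simp add: weighted_inner_def mult.assoc complex_norm_square del: of_real_power)

lemma weighted_inner_self_sq_norm: "weighted_inner m f f = of_real (sq_norm f)"
  by (simp add: weighted_inner_self sq_norm_def)

lemma sq_norm_nonneg: "sq_norm f \<ge> 0"
  unfolding sq_norm_def weighted_inner_self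
  by (auto intro!: sum_nonneg simp: pos less_imp_le)

lemma sq_norm_pos:
  assumes "f \<noteq> 0"
  shows "sq_norm f > 0"
proof -
  obtain x where "f $ x \<noteq> 0"
    using assms by (auto simp: vec_eq_iff)
  then have "(\<Sum>x\<in>UNIV. m x * (cmod (f $ x))\<^sup>2) > 0"
    by (intro sum_pos2[of _ x]) (auto simp: pos less_imp_le)
  then show ?thesis
    unfolding sq_norm_def weighted_inner_self by simp
qed

lemma sq_norm_eq_0_iff: "sq_norm f = 0 \<longleftrightarrow> f = 0"
  using sq_norm_pos[of f] by (cases "f = 0") (auto simp: sq_norm_def weighted_inner_simps)

lemma eigenvalue_real:
  assumes "f \<in> eigenspace T \<mu>" "f \<noteq> 0"
  shows "cnj \<mu> = \<mu>"
  using self_adjoint[of f f] assms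
  by (simp add: eigenspace_def weighted_inner_simps weighted_inner_self_sq_norm sq_norm_eq_0_iff)

lemma eigenspaces_orthogonal:
  assumes "f \<in> eigenspace T \<mu>" "g \<in> eigenspace T \<nu>" "\<mu> \<noteq> \<nu>"
  shows "weighted_inner m f g = 0"
\<comment> \<open>The split secures a nonzero eigenvector, from which \<open>eigenvalue_real\<close>
  gives that \<nu> is real.\<close>
proof (cases "g = 0")
  case False
  then have "cnj \<nu> = \<nu>"
    using assms eigenvalue_real by blast
  then have "\<mu> * weighted_inner m f g = \<nu> * weighted_inner m f g"
    using self_adjoint[of f g] assms by (simp add: eigenspace_def weighted_inner_simps)
  with assms show ?thesis by simp
qed (simp add: weighted_inner_simps)

section \<open>Sums of eigenspaces and their dimensions\<close>

lemma subspace_eigenspace: "vec.subspace (eigenspace T \<mu>)"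
  by (auto simp: vec.subspace_def eigenspace_def T_add T_scale T_zero vector_add_ldistrib
      vector_smult_assoc mult.commute)

definition eigenspan :: "complex set \<Rightarrow> (complex ^ 'v) set"
  where "eigenspan M = vec.span (\<Union>\<mu>\<in>M. eigenspace T \<mu>)"

lemma subspace_eigenspan: "vec.subspace (eigenspan M)"
  by (simp add: eigenspan_def)

lemma eigenspan_insert:
  "eigenspan (insert \<mu> M) = {f + g |f g. f \<in> eigenspace T \<mu> \<and> g \<in> eigenspan M}"
  unfolding eigenspan_def
  by (simp add: vec.span_Un subspace_eigenspace vec.span_eq_iff[THEN iffD2])

lemma eigenspan_orthogonal:
  assumes "f \<in> eigenspace T \<mu>" "\<mu> \<notin> M" "g \<in> eigenspan M"
  shows "weighted_inner m f g = 0"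
  using assms(3) unfolding eigenspan_def
proof (induction rule: vec.span_induct_alt)
  case base
  then show ?case by (simp add: weighted_inner_simps)
next
  case (step c x y)
  then obtain \<nu> where "\<nu> \<in> M" "x \<in> eigenspace T \<nu>" by blast
  then have "weighted_inner m f x = 0"
    using eigenspaces_orthogonal assms by metis
  with step show ?case by (simp add: weighted_inner_simps)
qed

text \<open>Each new eigenspace is orthogonal to the span of the others, so it meets that span only
  in 0 and the dimensions add.\<close>

lemma dim_eigenspan:
  assumes "finite M"
  shows "vec.dim (eigenspan M) = (\<Sum>\<mu>\<in>M. vec.dim (eigenspace T \<mu>))"
  using assms
proof induction
  case empty
  then show ?case by (simp add: eigenspan_def)
next
  case (insert \<mu> M)
  have "f = 0" if "f \<in> eigenspace T \<mu>" "f \<in> eigenspan M" for f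
    using eigenspan_orthogonal[OF that(1) insert(2) that(2)] sq_norm_eq_0_iff[of f]
    by (simp add: weighted_inner_self_sq_norm)
  then have "eigenspace T \<mu> \<inter> eigenspan M \<subseteq> {0}" by blast
  then have "vec.dim (eigenspace T \<mu> \<inter> eigenspan M) = 0"
    by (simp add: vec.dim_eq_0)
  with vec.dim_sums_Int[OF subspace_eigenspace[of \<mu>] subspace_eigenspan[of M]] insert
  show ?case
    by (simp add: eigenspan_insert)
qed

text \<open>Every eigenvalue contributes at least one dimension to a direct sum inside a space of
  dimension \<open>CARD('v)\<close>, which bounds the size of every finite set of
  eigenvalues.\<close>

lemma finite_spectrum: "finite (spectrum T)"
proof (rule finite_if_finite_subsets_card_bdd[THEN conjunct1])
  fix M assume M: "M \<subseteq> spectrum T" "finite M"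
  have "vec.dim (eigenspace T \<mu>) \<ge> 1" if "\<mu> \<in> M" for \<mu>
  proof -
    have "\<mu> \<in> spectrum T" using that M(1) by blast
    then obtain f where "f \<noteq> 0" "f \<in> eigenspace T \<mu>"
      by (auto simp: spectrum_def)
    then have "vec.dim (eigenspace T \<mu>) \<noteq> 0"
      by auto
    then show ?thesis by linarith
  qed
  then have "card M \<le> (\<Sum>\<mu>\<in>M. vec.dim (eigenspace T \<mu>))"
    using sum_bounded_below[of M 1 "\<lambda>\<mu>. vec.dim (eigenspace T \<mu>)"] by simp
  also have "\<dots> = vec.dim (eigenspan M)"
    using M by (simp add: dim_eigenspan)
  also have "\<dots> \<le> CARD('v)"
    by (rule dim_subset_UNIV_cart_gen)
  finally show "card M \<le> CARD('v)" .
qed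

section \<open>The quadratic form on sums of eigenspaces\<close>

lemma form_add_eigenvector:
  assumes "f \<in> eigenspace T \<mu>" "weighted_inner m f g = 0"
  shows "form (f + g) = Re \<mu> * sq_norm f + form g" "sq_norm (f + g) = sq_norm f + sq_norm g"
proof -
  have Tf: "T f = \<mu> *s f" using assms by (simp add: eigenspace_def)
  have gf: "weighted_inner m g f = 0"
    using assms weighted_inner_commute[of m g f] by simp
  \<comment> \<open>This cross term vanishes because self-adjointness moves \<open>T\<close> onto
    the eigenvector \<open>f\<close>.\<close>
  have "weighted_inner m (T g) f = 0"
    using Tf gf by (simp add: self_adjoint weighted_inner_simps)
  with assms Tf gf show "form (f + g) = Re \<mu> * sq_norm f + form g"
    by (simp add: form_def T_add weighted_inner_simps weighted_inner_self_sq_norm)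
  show "sq_norm (f + g) = sq_norm f + sq_norm g"
    using assms gf by (simp add: sq_norm_def weighted_inner_simps)
qed

text \<open>Pythagoras: \<open>c\<close> \<mu> is the squared norm of a component of
  \<open>f\<close> in the eigenspace of \<mu>. The form is thus a nonnegative combination of
  eigenvalues, so bounds on \<open>M\<close> carry over to the Rayleigh quotient.\<close>

lemma form_eigenspan:
  assumes "finite M" "f \<in> eigenspan M"
  shows "\<exists>c. (\<forall>\<mu>\<in>M. c \<mu> \<ge> 0) \<and> form f = (\<Sum>\<mu>\<in>M. Re \<mu> * c \<mu>) \<and> sq_norm f = (\<Sum>\<mu>\<in>M. c \<mu>)"
  using assms
proof (induction arbitrary: f)
  case empty
  then show ?case
    by (simp add: eigenspan_def form_def sq_norm_def weighted_inner_simps T_zero)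
next
  case (insert \<mu> M)
  obtain g h where gh: "f = g + h" "g \<in> eigenspace T \<mu>" "h \<in> eigenspan M"
    using insert.prems by (auto simp: eigenspan_insert)
  obtain c where c: "\<forall>\<mu>\<in>M. c \<mu> \<ge> 0" "form h = (\<Sum>\<mu>\<in>M. Re \<mu> * c \<mu>)" "sq_norm h = (\<Sum>\<mu>\<in>M. c \<mu>)"
    using insert.IH[OF gh(3)] by blast
  have "weighted_inner m g h = 0"
    using eigenspan_orthogonal gh insert.hyps by blast
  note * = form_add_eigenvector[OF gh(2) this]
  let ?c = "c(\<mu> := sq_norm g)"
  have "(\<Sum>\<nu>\<in>M. Re \<nu> * ?c \<nu>) = (\<Sum>\<nu>\<in>M. Re \<nu> * c \<nu>)" "(\<Sum>\<nu>\<in>M. ?c \<nu>) = (\<Sum>\<nu>\<in>M. c \<nu>)"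
    using insert.hyps by (auto intro!: sum.cong)
  with c * insert.hyps gh(1) show ?case
    by (intro exI[of _ ?c]) (auto simp: sq_norm_nonneg)
qed

lemma form_eigenspan_le:
  assumes "finite M" "f \<in> eigenspan M" "\<And>\<mu>. \<mu> \<in> M \<Longrightarrow> Re \<mu> \<le> t"
  shows "form f \<le> t * sq_norm f"
proof -
  obtain c where c: "\<forall>\<mu>\<in>M. c \<mu> \<ge> 0" "form f = (\<Sum>\<mu>\<in>M. Re \<mu> * c \<mu>)" "sq_norm f = (\<Sum>\<mu>\<in>M. c \<mu>)"
    using form_eigenspan assms by blast
  then show ?thesis
    by (auto simp: sum_distrib_left assms intro!: sum_mono mult_right_mono)
qed

lemma form_eigenspan_greater:
  assumes "finite M" "f \<in> eigenspan M" "\<And>\<mu>. \<mu> \<in> M \<Longrightarrow> Re \<mu> > t" "f \<noteq> 0"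
  shows "form f > t * sq_norm f"
proof -
  obtain c where c: "\<forall>\<mu>\<in>M. c \<mu> \<ge> 0" "form f = (\<Sum>\<mu>\<in>M. Re \<mu> * c \<mu>)" "sq_norm f = (\<Sum>\<mu>\<in>M. c \<mu>)"
    using form_eigenspan assms(1,2) by blast
  \<comment> \<open>A nonzero \<open>f\<close> has a nonzero component; it makes the termwise
    comparison strict.\<close>
  have "\<exists>\<mu>\<in>M. c \<mu> \<noteq> 0"
    using sq_norm_pos[OF assms(4)] c(3) by (metis less_irrefl sum.neutral)
  then obtain \<mu> where "\<mu> \<in> M" "c \<mu> > 0"
    using c(1) by fastforce
  then show ?thesis
    using c(1) assms unfolding c(2,3) sum_distrib_left
    by (intro sum_strict_mono_ex1) (auto intro!: mult_right_mono bexI[of _ \<mu>] simp: less_imp_le)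
qed

section \<open>Existence of eigenvectors and the spectral decomposition\<close>

lemma continuous_sq_norm: "continuous_on A sq_norm"
  unfolding sq_norm_def weighted_inner_def by (intro continuous_intros)

lemma continuous_form: "continuous_on A form"
proof -
  have "continuous_on A T"
    using linear_T by (rule linear_continuous_on_compose[OF continuous_on_id, simplified])
  then show ?thesis
    unfolding form_def weighted_inner_def by (intro continuous_intros)
qed

text \<open>The eigenvector is a minimiser of the Rayleigh quotient over \<open>W\<close>.\<close>

lemma eigenvector_in_invariant_subspace:
  assumes W: "vec.subspace W" "T ` W \<subseteq> W" and "W \<noteq> {0}"
  shows "\<exists>f\<in>W. f \<noteq> 0 \<and> (\<exists>\<mu>. f \<in> eigenspace T \<mu>)"
proof -
  have real_W: "subspace W"
    using W by (auto simp: subspace_def vec.subspace_def scaleR_eq_vector_scalar_mult)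
  have scale: "form (r *\<^sub>R f) = r\<^sup>2 * form f" "sq_norm (r *\<^sub>R f) = r\<^sup>2 * sq_norm f" for r f
    by (simp_all add: form_def sq_norm_def scaleR_eq_vector_scalar_mult T_scale
        weighted_inner_simps power2_eq_square)
  \<comment> \<open>The sphere is that of the standard norm, not of \<open>sq_norm\<close>. This is
    harmless: \<open>?R\<close> is invariant under scaling, so its minimum on \<open>?S\<close>
    bounds it on all nonzero vectors of \<open>W\<close>.\<close>
  let ?S = "W \<inter> sphere 0 1"
  let ?R = "\<lambda>f. form f / sq_norm f"
  obtain g where g: "g \<in> W" "g \<noteq> 0"
    using W(1) \<open>W \<noteq> {0}\<close> vec.subspace_0 by blast
  then have "(1 / norm g) *\<^sub>R g \<in> ?S"
    using real_W by (simp add: subspace_scale)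
  then have "?S \<noteq> {}" by blast
  moreover have "compact ?S"
    by (simp add: closed_Int_compact closed_subspace real_W)
  moreover have "continuous_on ?S ?R"
    by (intro continuous_on_divide continuous_form continuous_sq_norm)
      (auto simp: sq_norm_eq_0_iff)
  ultimately obtain f where f: "f \<in> ?S" "\<And>h. h \<in> ?S \<Longrightarrow> ?R f \<le> ?R h"
    by (metis (no_types, lifting) continuous_attains_inf)
  define \<mu> where "\<mu> = ?R f"
  have f0: "f \<noteq> 0" "f \<in> W" using f(1) by auto
  have form_f: "form f = \<mu> * sq_norm f"
    using sq_norm_pos[OF f0(1)] by (simp add: \<mu>_def)
  have form_ge: "form h - \<mu> * sq_norm h \<ge> 0" if "h \<in> W" for h
  proof (cases "h = 0")
    case False
    then have "(1 / norm h) *\<^sub>R h \<in> ?S"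
      using real_W that by (simp add: subspace_scale)
    from f(2)[OF this] have "\<mu> \<le> ?R h"
      using False unfolding \<mu>_def scale by simp
    then show ?thesis
      using sq_norm_pos[OF False] by (simp add: field_simps)
  qed (simp add: form_def sq_norm_def weighted_inner_simps)
  \<comment> \<open>The residual of the eigenvalue equation, to be shown zero. Invariance keeps it
    in \<open>W\<close>, so it is an admissible direction for perturbing \<open>f\<close>.\<close>
  define h where "h = T f - complex_of_real \<mu> *s f"
  have h: "h \<in> W"
    using W f0 by (auto simp: h_def intro!: vec.subspace_diff vec.subspace_scale)
  \<comment> \<open>\<open>form - \<mu> * sq_norm\<close> is nonnegative on \<open>W\<close> and
    vanishes at \<open>f\<close>; this is its expansion at \<open>f + s *\<^sub>R h\<close>.\<close>
  have "0 \<le> s * (2 * sq_norm h) + s\<^sup>2 * (form h - \<mu> * sq_norm h)" for s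
  proof -
    let ?p = "f + s *\<^sub>R h"
    have "form ?p = form f + s * (2 * Re (weighted_inner m (T f) h)) + s\<^sup>2 * form h"
      using weighted_inner_commute[of m "T f" h]
      by (simp add: form_def scaleR_eq_vector_scalar_mult T_add T_scale weighted_inner_simps
          self_adjoint[of h f] power2_eq_square algebra_simps)
    moreover have "sq_norm ?p = sq_norm f + s * (2 * Re (weighted_inner m f h)) + s\<^sup>2 * sq_norm h"
      using weighted_inner_commute[of m f h]
      by (simp add: sq_norm_def scaleR_eq_vector_scalar_mult weighted_inner_simps
          power2_eq_square algebra_simps)
    moreover have "Re (weighted_inner m (T f) h) - \<mu> * Re (weighted_inner m f h) = sq_norm h"
      by (simp add: sq_norm_def h_def weighted_inner_simps)
    moreover have "?p \<in> W"
      using real_W f0 h by (simp add: subspace_add subspace_scale)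
    ultimately show ?thesis
      using form_ge[of ?p] form_f by (simp add: algebra_simps)
  qed
  then have "2 * sq_norm h = 0" by (rule real_linear_coeff_zero)
  then have "T f = complex_of_real \<mu> *s f"
    by (simp add: sq_norm_eq_0_iff h_def)
  with f0 show ?thesis by (auto simp: eigenspace_def)
qed

text \<open>The orthogonal complement \<open>W\<close> of the span of all eigenvectors is invariant
  under \<open>T\<close>. If nonzero, it would contain an eigenvector, which would then be
  orthogonal to itself.\<close>

lemma eigenspan_spectrum: "eigenspan (spectrum T) = UNIV"
proof (rule ccontr)
  assume neq: "eigenspan (spectrum T) \<noteq> UNIV"
  let ?S = "eigenspan (spectrum T)"
  have S: "vec.subspace ?S" by (rule subspace_eigenspan)
  then have "subspace ?S"
    by (auto simp: subspace_def vec.subspace_def scaleR_eq_vector_scalar_mult)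
  then have "span ?S = ?S" by simp
  with neq obtain a where a: "a \<noteq> 0" "\<And>g. g \<in> ?S \<Longrightarrow> a \<bullet> g = 0"
    using span_not_UNIV_orthogonal[of ?S] by metis
  define W where "W = {f. \<forall>g\<in>?S. weighted_inner m f g = 0}"
  have W: "vec.subspace W"
    by (auto simp: W_def vec.subspace_def weighted_inner_simps)
  have "T g \<in> ?S" if "g \<in> ?S" for g
    using that unfolding eigenspan_def
  proof (induction rule: vec.span_induct_alt)
    case base
    then show ?case by (simp add: T_zero vec.span_zero)
  next
    case (step c x y)
    then obtain \<mu> where "T x = \<mu> *s x" "x \<in> vec.span (\<Union>\<mu>\<in>spectrum T. eigenspace T \<mu>)"
      by (auto simp: eigenspace_def intro!: vec.span_base)
    with step show ?case
      by (simp add: T_add T_scale vec.span_add vec.span_scale)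
  qed
  then have inv: "T ` W \<subseteq> W"
    by (auto simp: W_def self_adjoint)
  \<comment> \<open>\<open>a\<close> is orthogonal to \<open>?S\<close> only for the real dot
    product; dividing by \<open>m\<close> turns that product into the real part of the weighted
    one.\<close>
  define f where "f = (\<chi> x. a $ x / of_real (m x))"
  have m0: "m x \<noteq> 0" for x using pos[of x] by simp
  have Re_f: "Re (weighted_inner m f g) = a \<bullet> g" for g
    by (simp add: weighted_inner_def f_def m0 inner_vec_def inner_complex_def)
  have "weighted_inner m f g = 0" if "g \<in> ?S" for g
  proof -
    \<comment> \<open>Testing against \<open>\<i> *s g\<close> as well as \<open>g\<close> also
      gives the imaginary part.\<close>
    have "\<i> *s g \<in> ?S" using S that by (rule vec.subspace_scale)
    from a(2)[OF that] a(2)[OF this] have "Re (weighted_inner m f g) = 0" "Re (weighted_inner m f (\<i> *s g)) = 0"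
      by (simp_all add: Re_f)
    then show ?thesis by (simp add: weighted_inner_simps complex_eq_iff)
  qed
  then have "f \<in> W" by (simp add: W_def)
  moreover have "f \<noteq> 0"
    using a(1) m0 by (auto simp: f_def vec_eq_iff)
  ultimately have "W \<noteq> {0}" by blast
  from eigenvector_in_invariant_subspace[OF W inv this]
  obtain e \<mu> where e: "e \<in> W" "e \<noteq> 0" "e \<in> eigenspace T \<mu>" by blast
  then have "e \<in> ?S"
    by (auto simp: eigenspan_def spectrum_def intro!: vec.span_base)
  with e have "weighted_inner m e e = 0" by (simp add: W_def)
  with e show False by (simp add: weighted_inner_self_sq_norm sq_norm_eq_0_iff)
qed

section \<open>Counting eigenvalues and comparing two operators\<close>

lemma sum_dim_eigenspaces: "(\<Sum>\<mu>\<in>spectrum T. vec.dim (eigenspace T \<mu>)) = CARD('v)"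
  using dim_eigenspan[OF finite_spectrum] by (simp add: eigenspan_spectrum card_cart_basis)

lemma length_filter_eigenvalue_list:
  "length (filter P (eigenvalue_list T)) =
    (\<Sum>\<mu>\<in>{\<mu>\<in>spectrum T. P (Re \<mu>)}. vec.dim (eigenspace T \<mu>))"
proof -
  have replicate: "size (filter_mset P (replicate_mset n a)) = (if P a then n else 0)" for n a
    by (induction n) auto
  have *: "size (filter_mset P (\<Sum>\<mu>\<in>M. replicate_mset (d \<mu>) (Re \<mu>))) = (\<Sum>\<mu>\<in>{\<mu>\<in>M. P (Re \<mu>)}. d \<mu>)"
    if "finite M" for M and d :: "complex \<Rightarrow> nat"
    unfolding sum.inter_filter[OF that] using that
    by induction (auto simp: replicate)
  have "length (filter P (eigenvalue_list T)) = size (filter_mset P (mset (eigenvalue_list T)))"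
    by (simp flip: mset_filter)
  then show ?thesis
    by (simp add: eigenvalue_list_def *[OF finite_spectrum])
qed

lemma length_eigenvalue_list: "length (eigenvalue_list T) = CARD('v)"
  using length_filter_eigenvalue_list[of "\<lambda>_. True"] by (simp add: sum_dim_eigenspaces)

end

text \<open>Take \<open>t = ys ! i\<close>: at least \<open>i + 1\<close> entries of
  \<open>ys\<close> are at most \<open>t\<close>, but if \<open>xs ! i\<close> exceeded
  \<open>t\<close>, at most \<open>i\<close> entries of \<open>xs\<close> would be.\<close>

lemma sorted_nth_le_by_counting:
  fixes xs ys :: "'a::linorder list"
  assumes "sorted xs" "sorted ys" "i < length xs" "i < length ys"
    and count: "\<And>t. length (filter (\<lambda>x. x \<le> t) ys) \<le> length (filter (\<lambda>x. x \<le> t) xs)"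
  shows "xs ! i \<le> ys ! i"
proof (rule ccontr)
  assume less: "\<not> xs ! i \<le> ys ! i"
  let ?t = "ys ! i"
  have "{..i} \<subseteq> {j. j < length ys \<and> ys ! j \<le> ?t}"
    using assms by (auto intro: sorted_nth_mono)
  then have "card {..i} \<le> length (filter (\<lambda>x. x \<le> ?t) ys)"
    unfolding length_filter_conv_card by (rule card_mono[rotated]) simp
  moreover have "{j. j < length xs \<and> xs ! j \<le> ?t} \<subseteq> {..<i}"
    using assms less by (auto simp: not_le) (meson leD leI le_less_trans not_le order.trans sorted_nth_mono)
  then have "length (filter (\<lambda>x. x \<le> ?t) xs) \<le> card {..<i}"
    unfolding length_filter_conv_card by (rule card_mono[rotated]) simp
  ultimately show False using count[of ?t] by simp
qed

text \<open>Weyl's monotonicity principle, proved with counting functions in place of the min-max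
  formula.\<close>

lemma nth_eigenvalue_mono:
  fixes T T' :: "complex ^ 'v::finite \<Rightarrow> complex ^ 'v"
  assumes "weighted_self_adjoint m T" "weighted_self_adjoint m T'"
    and form_le: "\<And>f. Re (weighted_inner m (T f) f) \<le> Re (weighted_inner m (T' f) f)"
    and k: "k \<in> {1..CARD('v)}"
  shows "nth_eigenvalue T k \<le> nth_eigenvalue T' k"
proof -
  interpret T: weighted_self_adjoint m T by fact
  interpret T': weighted_self_adjoint m T' by fact
  have "length (filter (\<lambda>x. x \<le> t) (eigenvalue_list T')) \<le> length (filter (\<lambda>x. x \<le> t) (eigenvalue_list T))"
    for t
  proof -
    let ?M' = "{\<mu>\<in>spectrum T'. Re \<mu> \<le> t}"
    let ?M = "{\<mu>\<in>spectrum T. \<not> Re \<mu> \<le> t}"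
    let ?U = "T'.eigenspan ?M'" and ?V = "T.eigenspan ?M"
    have fin: "finite ?M'" "finite ?M"
      by (simp_all add: T.finite_spectrum T'.finite_spectrum)
    have "f = 0" if "f \<in> ?U" "f \<in> ?V" for f
    proof (rule ccontr)
      assume "f \<noteq> 0"
      then have "t * T.sq_norm f < T.form f"
        by (intro T.form_eigenspan_greater[OF fin(2) that(2)]) auto
      also have "\<dots> \<le> T'.form f"
        unfolding T.form_def T'.form_def by (rule form_le)
      also have "\<dots> \<le> t * T'.sq_norm f"
        by (intro T'.form_eigenspan_le[OF fin(1) that(1)]) auto
      finally show False
        by (simp add: T.sq_norm_def T'.sq_norm_def)
    qed
    then have "?U \<inter> ?V \<subseteq> {0}" by blast
    then have "vec.dim (?U \<inter> ?V) = 0"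
      by (simp add: vec.dim_eq_0)
    then have "vec.dim ?U + vec.dim ?V = vec.dim {f + g |f g. f \<in> ?U \<and> g \<in> ?V}"
      using vec.dim_sums_Int[of ?U ?V] T.subspace_eigenspan T'.subspace_eigenspan
      by (simp del: vec.dim_eq_0)
    also have "\<dots> \<le> CARD('v)"
      by (rule dim_subset_UNIV_cart_gen)
    \<comment> \<open>\<open>?U\<close> counts the eigenvalues of \<open>T'\<close> up to
      \<open>t\<close>, and \<open>?V\<close> those of \<open>T\<close> above \<open>t\<close>; the
      latter number is \<open>CARD('v)\<close> minus the count up to \<open>t\<close>.\<close>
    finally have "length (filter (\<lambda>x. x \<le> t) (eigenvalue_list T')) +
        length (filter (\<lambda>x. \<not> x \<le> t) (eigenvalue_list T)) \<le> CARD('v)"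
      by (simp add: T.dim_eigenspan T'.dim_eigenspan fin
          T.length_filter_eigenvalue_list T'.length_filter_eigenvalue_list del: not_le)
    then show ?thesis
      using sum_length_filter_compl[of "\<lambda>x. x \<le> t" "eigenvalue_list T"]
      by (simp add: T.length_eigenvalue_list)
  qed
  then show ?thesis
    unfolding nth_eigenvalue_def using k
    by (intro sorted_nth_le_by_counting)
      (auto simp: T.length_eigenvalue_list T'.length_eigenvalue_list,
       auto simp: eigenvalue_list_def)
qed

section \<open>The quadratic form of the special Laplacian\<close>

context weighted_digraph
begin

lemma weight_eq_0: "(x, y) \<notin> E \<Longrightarrow> b x y = 0"
  using weight_nonneg[of x y] weight_pos_iff[of x y] by linarith

text \<open>Weights vanish off the edges, so the sum may run over all vertices; its range no longer
  depends on \<open>E\<close> or \<open>x\<close>, and double sums can be swapped.\<close>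

lemma special_laplacian_sum_UNIV:
  "of_real (m x) * special_laplacian E b m f $ x =
    (\<Sum>y\<in>UNIV. of_real (sym_weight b x y) * (f $ x - f $ y))"
proof -
  have "(\<Sum>y\<in>nbrs E x. of_real (sym_weight b x y) * (f $ x - f $ y)) =
      (\<Sum>y\<in>UNIV. of_real (sym_weight b x y) * (f $ x - f $ y))"
    by (rule sum.mono_neutral_left)
      (auto simp: sym_weight_def nbrs_def out_nbrs_def in_nbrs_def weight_eq_0)
  then show ?thesis
    using measure_pos[of x] by (simp add: special_laplacian_def)
qed

lemma special_laplacian_form:
  "Re (weighted_inner m (special_laplacian E b m f) f) =
    (\<Sum>x\<in>UNIV. \<Sum>y\<in>UNIV. sym_weight b x y * (cmod (f $ x - f $ y))\<^sup>2) / 2"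
proof -
  let ?a = "\<lambda>x y. complex_of_real (sym_weight b x y)"
  let ?I = "weighted_inner m (special_laplacian E b m f) f"
  have I: "?I = (\<Sum>x\<in>UNIV. \<Sum>y\<in>UNIV. ?a x y * (f $ x - f $ y) * cnj (f $ x))"
    unfolding weighted_inner_def special_laplacian_sum_UNIV sum_distrib_right ..
  \<comment> \<open>Exchanging the roles of \<open>x\<close> and \<open>y\<close>, by symmetry of
    the weight; adding both versions of the sum produces the squares.\<close>
  also have "\<dots> = (\<Sum>x\<in>UNIV. \<Sum>y\<in>UNIV. ?a x y * (f $ y - f $ x) * cnj (f $ y))"
    by (subst sum.swap) (simp add: sym_weight_def add.commute)
  finally have "?I + ?I = (\<Sum>x\<in>UNIV. \<Sum>y\<in>UNIV. ?a x y * ((f $ x - f $ y) * cnj (f $ x - f $ y)))"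
    by (subst I) (simp add: algebra_simps flip: sum.distrib)
  also have "\<dots> = of_real (\<Sum>x\<in>UNIV. \<Sum>y\<in>UNIV. sym_weight b x y * (cmod (f $ x - f $ y))\<^sup>2)"
    by (simp add: complex_norm_square del: of_real_power complex_cnj_diff)
  finally have "Re (?I + ?I) = (\<Sum>x\<in>UNIV. \<Sum>y\<in>UNIV. sym_weight b x y * (cmod (f $ x - f $ y))\<^sup>2)"
    by (simp only: Re_complex_of_real)
  then show ?thesis by simp
qed

lemma special_laplacian_weighted_self_adjoint:
  "weighted_self_adjoint m (special_laplacian E b m)"
proof
  show "special_laplacian E b m (f + g) = special_laplacian E b m f + special_laplacian E b m g" for f g
    by (simp add: special_laplacian_def vec_eq_iff algebra_simps sum.distrib sum_subtractf add_divide_distrib diff_divide_distrib)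
  show "special_laplacian E b m (c *s f) = c *s special_laplacian E b m f" for c f
    by (simp add: special_laplacian_def vec_eq_iff sum_distrib_left algebra_simps)
qed (rule measure_pos special_laplacian_self_adjoint)+

end

theorem corollary3p4:
  fixes E E1 :: "('v::finite \<times> 'v) set"
    and b b1 :: "'v \<Rightarrow> 'v \<Rightarrow> real"
    and m :: "'v \<Rightarrow> real"
    and k :: nat
  assumes "standing_digraph E b m"
    and "standing_digraph E1 b1 m"
    and "adds_edges E b E1 b1"
    and "k \<in> {1..CARD('v)}"
  shows "nth_eigenvalue (special_laplacian E b m) k \<le> nth_eigenvalue (special_laplacian E1 b1 m) k"
proof -
  interpret G: standing_digraph E b m by fact
  interpret G1: standing_digraph E1 b1 m by fact
  \<comment> \<open>On \<open>E\<close> the weights agree; off \<open>E\<close> the old one is 0 and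
    the new one nonnegative.\<close>
  have "b x y \<le> b1 x y" for x y
    using assms(3) G.weight_eq_0[of x y] G1.weight_nonneg[of x y]
    by (cases "(x, y) \<in> E") (auto simp: adds_edges_def)
  then have "sym_weight b x y \<le> sym_weight b1 x y" for x y
    by (simp add: sym_weight_def add_mono)
  then have "Re (weighted_inner m (special_laplacian E b m f) f) \<le>
      Re (weighted_inner m (special_laplacian E1 b1 m f) f)" for f
    unfolding G.special_laplacian_form G1.special_laplacian_form
    by (intro divide_right_mono sum_mono mult_right_mono) auto
  with assms(4) show ?thesis
    by (intro nth_eigenvalue_mono[OF G.special_laplacian_weighted_self_adjoint
          G1.special_laplacian_weighted_self_adjoint])
qed

end
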